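(* There exists a surjective (linear) isometry from $\mathcal D(\mathbb H)$ onto $\mathcal D(\mathbb D\times\mathbb D)$, the Dirichlet space on the bidisc.
   Context: $\mathbb D$ is the open unit disc in $\mathbb C$ and $\mathbb H=\{(z_1,z_2)\in\mathbb C^2:|z_1|<|z_2|<1\}$ is the Hartogs triangle. Every holomorphic function on $\mathbb H$ has a Laurent expansion $\sum_{j\ge0}\sum_{k\in\mathbb Z}a_{jk}z_1^jz_2^k$. The Dirichlet space $\mathcal D(\mathbb H)$ on the Hartogs triangle is the space of holomorphic functions on $\mathbb H$ of the form $f(z_1,z_2)=\sum_{j=0}^{+\infty}\sum_{k=-j}^{+\infty}a_{jk}z_1^jz_2^k$ with $$\|f\|^2_{\mathcal D}=\sum_{j=0}^{+\infty}\sum_{k=-j}^{+\infty}(j+1)(j+k+1)|a_{jk}|^2<+\infty,$$ endowed with this norm. The Dirichlet space on the bidisc $\mathcal D(\mathbb D\times\mathbb D)$ is the space of holomorphic functions $f(w_1,w_2)=\sum_{j=0}^{+\infty}\sum_{k=0}^{+\infty}a_{jk}w_1^jw_2^k$ on $\mathbb D\times\mathbb D$ with $$\|f\|^2_{\mathcal D(\mathbb D^2)}=\sum_{j=0}^{+\infty}\sum_{k=0}^{+\infty}(j+1)(k+1)|a_{jk}|^2<+\infty,$$ endowed with this norm. *)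

theory Defs
  imports "HOL-Analysis.Analysis"
begin

definition bidisc :: "(complex \<times> complex) set" where
  "bidisc = ball 0 1 \<times> ball 0 1"

definition hartogs_triangle :: "(complex \<times> complex) set" where
  "hartogs_triangle = {(z1, z2). cmod z1 < cmod z2 \<and> cmod z2 < 1}"

text \<open>Holomorphy in two complex variables: Frechet differentiability with a complex-linear
  derivative, which is necessarily of the form \<open>h \<mapsto> A * fst h + B * snd h\<close>.\<close>

definition holomorphic2_on ::
    "(complex \<times> complex \<Rightarrow> complex) \<Rightarrow> (complex \<times> complex) set \<Rightarrow> bool" where
  "holomorphic2_on f S \<longleftrightarrow>
     (\<forall>p\<in>S. \<exists>A B. (f has_derivative (\<lambda>h. A * fst h + B * snd h)) (at p within S))"

text \<open>A function on a domain \<open>S\<close> is represented by the total function that agrees with it on \<open>S\<close>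
  and is \<open>0\<close> off \<open>S\<close>; equality and the pointwise linear operations of total functions are then
  those of functions on \<open>S\<close>.\<close>

definition holo_space :: "(complex \<times> complex) set \<Rightarrow> (complex \<times> complex \<Rightarrow> complex) set" where
  "holo_space S = {f. holomorphic2_on f S \<and> (\<forall>p. p \<notin> S \<longrightarrow> f p = 0)}"

definition hartogs_index :: "(nat \<times> int) set" where
  "hartogs_index = {(j, k). - int j \<le> k}"

text \<open>The double series are unconditional (hence absolutely convergent) sums. The coefficients off
  the index set are normalised to \<open>0\<close>, so that an expansion determines the whole function \<open>a\<close>.\<close>

definition hartogs_expansion ::
    "(complex \<times> complex \<Rightarrow> complex) \<Rightarrow> (nat \<times> int \<Rightarrow> complex) \<Rightarrow> bool" where
  "hartogs_expansion f a \<longleftrightarrow>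
     (\<forall>i. i \<notin> hartogs_index \<longrightarrow> a i = 0) \<and>
     (\<forall>(z1, z2)\<in>hartogs_triangle.
        ((\<lambda>(j, k). a (j, k) * z1 ^ j * z2 powi k) has_sum f (z1, z2)) hartogs_index)"

definition hartogs_coeffs :: "(complex \<times> complex \<Rightarrow> complex) \<Rightarrow> nat \<times> int \<Rightarrow> complex" where
  "hartogs_coeffs f = (THE a. hartogs_expansion f a)"

definition hartogs_weighted :: "(nat \<times> int \<Rightarrow> complex) \<Rightarrow> nat \<times> int \<Rightarrow> real" where
  "hartogs_weighted a =
     (\<lambda>(j, k). (real j + 1) * (real j + real_of_int k + 1) * (cmod (a (j, k)))\<^sup>2)"

definition dirichlet_hartogs :: "(complex \<times> complex \<Rightarrow> complex) set" where
  "dirichlet_hartogs =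
     {f \<in> holo_space hartogs_triangle.
        \<exists>a. hartogs_expansion f a \<and> hartogs_weighted a summable_on hartogs_index}"

definition dirichlet_hartogs_norm :: "(complex \<times> complex \<Rightarrow> complex) \<Rightarrow> real" where
  "dirichlet_hartogs_norm f = sqrt (infsum (hartogs_weighted (hartogs_coeffs f)) hartogs_index)"

definition bidisc_expansion ::
    "(complex \<times> complex \<Rightarrow> complex) \<Rightarrow> (nat \<times> nat \<Rightarrow> complex) \<Rightarrow> bool" where
  "bidisc_expansion f a \<longleftrightarrow>
     (\<forall>(w1, w2)\<in>bidisc. ((\<lambda>(j, k). a (j, k) * w1 ^ j * w2 ^ k) has_sum f (w1, w2)) UNIV)"

definition bidisc_coeffs :: "(complex \<times> complex \<Rightarrow> complex) \<Rightarrow> nat \<times> nat \<Rightarrow> complex" where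
  "bidisc_coeffs f = (THE a. bidisc_expansion f a)"

definition bidisc_weighted :: "(nat \<times> nat \<Rightarrow> complex) \<Rightarrow> nat \<times> nat \<Rightarrow> real" where
  "bidisc_weighted a = (\<lambda>(j, k). (real j + 1) * (real k + 1) * (cmod (a (j, k)))\<^sup>2)"

definition dirichlet_bidisc :: "(complex \<times> complex \<Rightarrow> complex) set" where
  "dirichlet_bidisc =
     {f \<in> holo_space bidisc. \<exists>a. bidisc_expansion f a \<and> bidisc_weighted a summable_on UNIV}"

definition dirichlet_bidisc_norm :: "(complex \<times> complex \<Rightarrow> complex) \<Rightarrow> real" where
  "dirichlet_bidisc_norm f = sqrt (infsum (bidisc_weighted (bidisc_coeffs f)) UNIV)"

end

theory Submission imports Defs begin

text \<open>The change of variables \<open>f \<mapsto> F\<close>, \<open>F (w1, w2) = f (w1 * w2, w2)\<close>, carries the monomial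
  \<open>z1\<^sup>j z2\<^sup>k\<close> to \<open>w1\<^sup>j w2\<^sup>m\<close> with \<open>m = j + k\<close>. So it matches \<open>k \<ge> - j\<close> with \<open>m \<ge> 0\<close> and the
  weight \<open>(j + 1) (j + k + 1)\<close> with \<open>(j + 1) (m + 1)\<close>. It defines \<open>F\<close> only for \<open>w2 \<noteq> 0\<close>, but the
  resulting power series converges on the whole bidisc and its sum is holomorphic there.\<close>

section \<open>Uniqueness of the coefficients of double power series\<close>

text \<open>Strong induction: once the lower coefficients vanish, dividing by \<open>z ^ n\<close>
  leaves a series with constant term \<open>c n\<close> whose sum is 0 off the origin. Its limit at
  the origin is both \<open>c n\<close> and 0.\<close>

lemma powser_coeffs_zero:
  fixes c :: "nat \<Rightarrow> complex"
  assumes "\<And>z. z \<noteq> 0 \<Longrightarrow> cmod z < 1 \<Longrightarrow> (\<lambda>n. c n * z ^ n) sums 0"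
  shows "c n = 0"
proof (induction n rule: less_induct)
  case (less n)
  have "(\<lambda>m. c (m + n) * z ^ m) sums 0" if z: "z \<noteq> 0" "cmod z < 1" for z
  proof -
    have "(\<Sum>i<n. c i * z ^ i) = 0"
      using less by simp
    then have "(\<lambda>m. c (m + n) * z ^ (m + n)) sums 0"
      using sums_split_initial_segment[OF assms[OF z], of n] by simp
    then have "(\<lambda>m. (c (m + n) * z ^ (m + n)) / z ^ n) sums (0 / z ^ n)"
      by (rule sums_divide)
    then show ?thesis
      using z by (simp add: power_add)
  qed
  then have "((\<lambda>_. 0) \<longlongrightarrow> c (0 + n)) (at (0::complex))"
    by (intro powser_limit_0_strong[where s = 1 and a = "\<lambda>m. c (m + n)"]) auto
  then show "c n = 0"
    by (auto dest: LIM_const_eq)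
qed

text \<open>The one-variable case is applied twice. For fixed \<open>w2\<close>, summing over
  \<open>k\<close> first gives a power series in \<open>w1\<close>, so every inner sum is 0; each
  inner sum is in turn a power series in \<open>w2\<close> on the punctured disc.\<close>

lemma powser2_coeffs_zero:
  fixes c :: "nat \<times> nat \<Rightarrow> complex"
  assumes sum0: "\<And>w1 w2. w2 \<noteq> 0 \<Longrightarrow> cmod w1 < 1 \<Longrightarrow> cmod w2 < 1 \<Longrightarrow>
    ((\<lambda>(j, k). c (j, k) * w1 ^ j * w2 ^ k) has_sum 0) UNIV"
  shows "c i = 0"
proof -
  obtain j k where i: "i = (j, k)"
    by (cases i)
  have "(\<lambda>k. c (j, k) * w2 ^ k) sums 0" if w2: "w2 \<noteq> 0" "cmod w2 < 1" for w2
  proof -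
    have row: "(\<lambda>k. c (j, k) * w2 ^ k) summable_on UNIV" for j
    proof -
      \<comment> \<open>Any nonzero \<open>w1\<close> in the disc would do: a row of the family
        summable at \<open>(1/2, w2)\<close> is summable, and the factor \<open>2 ^ j\<close> then
        removes the power of \<open>1/2\<close>.\<close>
      have "(\<lambda>(j, k). c (j, k) * (1/2) ^ j * w2 ^ k) summable_on (UNIV \<times> UNIV)"
        using sum0[of w2 "1/2"] w2 by (auto simp: summable_on_def norm_divide)
      then have "(\<lambda>k. c (j, k) * (1/2) ^ j * w2 ^ k) summable_on UNIV"
        using summable_on_SigmaD1[of "\<lambda>j k. c (j, k) * (1/2) ^ j * w2 ^ k" UNIV "\<lambda>_. UNIV" j] by auto
      then have "(\<lambda>k. 2 ^ j * (c (j, k) * (1/2) ^ j * w2 ^ k)) summable_on UNIV"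
        by (rule summable_on_cmult_right)
      then show ?thesis
        by (simp add: power_one_over)
    qed
    have "(\<lambda>j. (\<Sum>\<^sub>\<infinity>k. c (j, k) * w2 ^ k) * w1 ^ j) sums 0" if "cmod w1 < 1" for w1
    proof (rule has_sum_imp_sums, rule has_sum_SigmaD)
      show "((\<lambda>(j, k). c (j, k) * w1 ^ j * w2 ^ k) has_sum 0) (SIGMA _:UNIV. UNIV)"
        using sum0[OF w2(1) that w2(2)] by simp
      show "((\<lambda>k. case (j, k) of (j, k) \<Rightarrow> c (j, k) * w1 ^ j * w2 ^ k)
        has_sum (\<Sum>\<^sub>\<infinity>k. c (j, k) * w2 ^ k) * w1 ^ j) UNIV" for j
        using has_sum_cmult_left[OF has_sum_infsum[OF row[of j]], of "w1 ^ j"]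
        by (simp add: mult_ac)
    qed
    then have "(\<Sum>\<^sub>\<infinity>k. c (j, k) * w2 ^ k) = 0"
      by (intro powser_coeffs_zero[where c = "\<lambda>j. \<Sum>\<^sub>\<infinity>k. c (j, k) * w2 ^ k"]) auto
    then show ?thesis
      using has_sum_imp_sums[OF has_sum_infsum[OF row[of j]]] by simp
  qed
  then show ?thesis
    unfolding i by (intro powser_coeffs_zero[where c = "\<lambda>k. c (j, k)"]) auto
qed

lemma powser2_coeffs_unique:
  assumes a: "\<And>w1 w2. w2 \<noteq> 0 \<Longrightarrow> cmod w1 < 1 \<Longrightarrow> cmod w2 < 1 \<Longrightarrow>
      ((\<lambda>(j, k). a (j, k) * w1 ^ j * w2 ^ k) has_sum s (w1, w2)) UNIV"
    and b: "\<And>w1 w2. w2 \<noteq> 0 \<Longrightarrow> cmod w1 < 1 \<Longrightarrow> cmod w2 < 1 \<Longrightarrow>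
      ((\<lambda>(j, k). b (j, k) * w1 ^ j * w2 ^ k) has_sum s (w1, w2)) UNIV"
  shows "a = (b :: nat \<times> nat \<Rightarrow> complex)"
proof
  fix i
  have "a i - b i = 0"
  proof (rule powser2_coeffs_zero[where c = "\<lambda>i. a i - b i"])
    fix w1 w2 :: complex
    assume w: "w2 \<noteq> 0" "cmod w1 < 1" "cmod w2 < 1"
    show "((\<lambda>(j, k). (a (j, k) - b (j, k)) * w1 ^ j * w2 ^ k) has_sum 0) UNIV"
      using has_sum_add[OF a[OF w] has_sum_uminusI[OF b[OF w]]]
      by (simp add: case_prod_unfold left_diff_distrib)
  qed
  then show "a i = b i"
    by simp
qed

section \<open>Holomorphy of double power series and of pullbacks\<close>

text \<open>In \<open>\<rho>\<^sup>j - r\<^sup>j = (\<rho> - r) * (\<Sum>p<j. \<rho>\<^sup>p r\<^sup>j\<^sup>-\<^sup>1\<^sup>-\<^sup>p)\<close> each summand is at least \<open>r\<^sup>j\<^sup>-\<^sup>1\<close>.\<close>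

lemma power_derivative_le:
  fixes r \<rho> :: real
  assumes "0 \<le> r" "r < \<rho>"
  shows "real j * r ^ (j - 1) \<le> \<rho> ^ j / (\<rho> - r)"
proof (cases j)
  case (Suc m)
  have "real j * r ^ m = (\<Sum>p<Suc m. r ^ p * r ^ (m - p))"
    by (simp add: Suc flip: power_add)
  also have "\<dots> \<le> (\<Sum>p<Suc m. \<rho> ^ p * r ^ (m - p))"
    using assms by (intro sum_mono mult_right_mono power_mono) auto
  finally have "(\<rho> - r) * (real j * r ^ m) \<le> (\<rho> - r) * (\<Sum>p<Suc m. \<rho> ^ p * r ^ (m - p))"
    using assms by (intro mult_left_mono) auto
  also have "\<dots> = \<rho> ^ j - r ^ j"
    by (simp only: Suc diff_power_eq_sum)
  also have "\<dots> \<le> \<rho> ^ j"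
    using assms by simp
  finally show ?thesis
    using assms by (simp add: Suc field_simps)
qed (use assms in auto)

lemma open_bidisc: "open bidisc"
  unfolding bidisc_def by (intro open_Times) auto

lemma mem_bidisc: "w \<in> bidisc \<longleftrightarrow> cmod (fst w) < 1 \<and> cmod (snd w) < 1"
  by (cases w) (auto simp: bidisc_def)

lemma bidisc_expansion_mem:
  assumes "bidisc_expansion F b" "w \<in> bidisc"
  shows "((\<lambda>i. b i * fst w ^ fst i * snd w ^ snd i) has_sum F w) UNIV"
  using assms by (cases w) (auto simp: bidisc_expansion_def case_prod_unfold)

text \<open>Termwise differentiation: on a smaller bidisc around the given point, the series of both
  partial derivatives have a common summable majorant, so they converge uniformly there.\<close>

lemma bidisc_expansion_imp_holomorphic2_on:
  assumes F: "bidisc_expansion F b"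
  shows "holomorphic2_on F bidisc"
  unfolding holomorphic2_on_def
proof
  fix p assume "p \<in> bidisc"
  then have "max (cmod (fst p)) (cmod (snd p)) < 1"
    by (simp add: mem_bidisc)
  then obtain r where "max (cmod (fst p)) (cmod (snd p)) < r" and r1: "r < 1"
    using dense by blast
  then have p: "cmod (fst p) < r" "cmod (snd p) < r"
    by auto
  then have r0: "0 \<le> r"
    by (meson norm_ge_zero le_less_trans less_imp_le)
  \<comment> \<open>The gap between \<open>r\<close> and \<open>\<rho>\<close> absorbs the factors
    \<open>J n\<close> and \<open>K n\<close> that differentiation produces.\<close>
  obtain \<rho> where \<rho>: "r < \<rho>" "\<rho> < 1"
    using dense r1 by blast
  define S :: "(complex \<times> complex) set" where "S = ball 0 r \<times> ball 0 r"
  have S_bidisc: "S \<subseteq> bidisc"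
    using r1 by (auto simp: S_def mem_bidisc)
  have pS: "p \<in> S"
    using p by (cases p) (auto simp: S_def)
  have "open S"
    unfolding S_def by (intro open_Times) auto
  \<comment> \<open>Enumerating the index pairs by \<open>prod_decode\<close> turns the
    unconditional double sum into an ordinary series, the form that the Weierstrass test and
    termwise differentiation require.\<close>
  define J where "J n = fst (prod_decode n)" for n
  define K where "K n = snd (prod_decode n)" for n
  define c where "c n = b (prod_decode n)" for n
  define f where "f n x = c n * fst x ^ J n * snd x ^ K n" for n and x :: "complex \<times> complex"
  \<comment> \<open>For \<open>J n = 0\<close> the truncated exponent \<open>J n - 1\<close> is
    harmless because of the factor \<open>of_nat (J n)\<close>; likewise for \<open>K n\<close> in
    \<open>\<beta>\<close>.\<close>
  define \<alpha> where "\<alpha> n x = c n * (of_nat (J n) * fst x ^ (J n - 1)) * snd x ^ K n"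
    for n and x :: "complex \<times> complex"
  define \<beta> where "\<beta> n x = c n * fst x ^ J n * (of_nat (K n) * snd x ^ (K n - 1))"
    for n and x :: "complex \<times> complex"
  \<comment> \<open>This is the modulus of the term at \<open>(\<rho>, \<rho>)\<close> divided by
    \<open>\<rho> - r\<close>: the differentiated power costs the division, the other power is only
    enlarged. Summability follows from absolute convergence at
    \<open>(\<rho>, \<rho>)\<close>.\<close>
  define M where "M n = cmod (c n) * \<rho> ^ J n * \<rho> ^ K n / (\<rho> - r)" for n
  have f_sums: "(\<lambda>n. f n x) sums F x" if "x \<in> bidisc" for x
    using has_sum_reindex_bij_betw[OF bij_prod_decode] bidisc_expansion_mem[OF F that]
    unfolding f_def c_def J_def K_def by (intro has_sum_imp_sums) fast
  have "summable M"
  proof -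
    have "(of_real \<rho>, of_real \<rho>) \<in> bidisc"
      using r0 \<rho> by (simp add: mem_bidisc)
    from bidisc_expansion_mem[OF F this]
    have "(\<lambda>i. cmod (b i * of_real \<rho> ^ fst i * of_real \<rho> ^ snd i)) summable_on UNIV"
      by (simp add: has_sum_imp_summable flip: summable_on_iff_abs_summable_on_complex)
    then have "(\<lambda>n. cmod (c n) * \<rho> ^ J n * \<rho> ^ K n) summable_on UNIV"
      using r0 \<rho> summable_on_reindex_bij_betw[OF bij_prod_decode,
          of "\<lambda>i. cmod (b i) * \<rho> ^ fst i * \<rho> ^ snd i"]
      by (simp add: norm_mult norm_power c_def J_def K_def)
    then show ?thesis
      unfolding M_def by (intro summable_divide summable_on_imp_summable)
  qed
  have \<alpha>_le: "cmod (\<alpha> n x) \<le> M n" and \<beta>_le: "cmod (\<beta> n x) \<le> M n" if "x \<in> S" for n x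
  proof -
    have x: "cmod (fst x) \<le> r" "cmod (snd x) \<le> r"
      using that by (auto simp: S_def)
    have pow: "cmod y ^ m \<le> \<rho> ^ m" if "cmod y \<le> r" for y :: complex and m
      using that \<rho> by (intro power_mono) auto
    have dpow: "real m * cmod y ^ (m - 1) \<le> \<rho> ^ m / (\<rho> - r)" if "cmod y \<le> r" for y :: complex and m
      using that mult_left_mono[OF power_mono[OF that, of "m - 1"], of "real m"]
        power_derivative_le[OF r0 \<rho>(1), of m] by simp
    have "cmod (\<alpha> n x) = cmod (c n) * (real (J n) * cmod (fst x) ^ (J n - 1)) * cmod (snd x) ^ K n"
      by (simp add: \<alpha>_def norm_mult norm_power)
    also have "\<dots> \<le> cmod (c n) * (\<rho> ^ J n / (\<rho> - r)) * \<rho> ^ K n"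
      using x r0 \<rho> by (intro mult_mono mult_left_mono pow dpow) auto
    finally show "cmod (\<alpha> n x) \<le> M n"
      by (simp add: M_def)
    have "cmod (\<beta> n x) = cmod (c n) * cmod (fst x) ^ J n * (real (K n) * cmod (snd x) ^ (K n - 1))"
      by (simp add: \<beta>_def norm_mult norm_power)
    also have "\<dots> \<le> cmod (c n) * \<rho> ^ J n * (\<rho> ^ K n / (\<rho> - r))"
      using x r0 \<rho> by (intro mult_mono mult_left_mono pow dpow) auto
    finally show "cmod (\<beta> n x) \<le> M n"
      by (simp add: M_def)
  qed
  have lim\<alpha>: "uniform_limit S (\<lambda>n x. \<Sum>i<n. \<alpha> i x) (\<lambda>x. \<Sum>i. \<alpha> i x) sequentially"
    using \<alpha>_le \<open>summable M\<close> by (rule Weierstrass_m_test)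
  have lim\<beta>: "uniform_limit S (\<lambda>n x. \<Sum>i<n. \<beta> i x) (\<lambda>x. \<Sum>i. \<beta> i x) sequentially"
    using \<beta>_le \<open>summable M\<close> by (rule Weierstrass_m_test)
  have "\<exists>g. \<forall>x\<in>S. (\<lambda>n. f n x) sums g x \<and>
    (g has_derivative (\<lambda>h. (\<Sum>i. \<alpha> i x) * fst h + (\<Sum>i. \<beta> i x) * snd h)) (at x within S)"
  proof (rule has_derivative_series)
    show "convex S"
      unfolding S_def by (intro convex_Times convex_ball)
    show "(f n has_derivative (\<lambda>h. \<alpha> n x * fst h + \<beta> n x * snd h)) (at x within S)" for n x
      unfolding f_def \<alpha>_def \<beta>_def
      by (rule derivative_eq_intros refl | simp add: algebra_simps)+
    \<comment> \<open>Each partial derivative contributes at most \<open>e / 2 * norm h\<close>,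
      since both components of \<open>h\<close> are bounded by \<open>norm h\<close>.\<close>
    show "\<forall>\<^sub>F n in sequentially. \<forall>x\<in>S. \<forall>h. norm ((\<Sum>i<n. \<alpha> i x * fst h + \<beta> i x * snd h) -
        ((\<Sum>i. \<alpha> i x) * fst h + (\<Sum>i. \<beta> i x) * snd h)) \<le> e * norm h" if "e > 0" for e
    proof -
      have "\<forall>\<^sub>F n in sequentially. \<forall>x\<in>S. dist (\<Sum>i<n. \<alpha> i x) (\<Sum>i. \<alpha> i x) < e / 2"
           "\<forall>\<^sub>F n in sequentially. \<forall>x\<in>S. dist (\<Sum>i<n. \<beta> i x) (\<Sum>i. \<beta> i x) < e / 2"
        using lim\<alpha> lim\<beta> that half_gt_zero unfolding uniform_limit_iff by blast+
      then show ?thesis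
      proof eventually_elim
        case (elim n)
        show ?case
        proof (intro ballI allI)
          fix x and h :: "complex \<times> complex" assume x: "x \<in> S"
          define u where "u = (\<Sum>i<n. \<alpha> i x) - (\<Sum>i. \<alpha> i x)"
          define v where "v = (\<Sum>i<n. \<beta> i x) - (\<Sum>i. \<beta> i x)"
          have uv: "norm u \<le> e / 2" "norm v \<le> e / 2"
            using elim x unfolding u_def v_def dist_norm by (auto intro: less_imp_le)
          have "(\<Sum>i<n. \<alpha> i x * fst h + \<beta> i x * snd h) -
              ((\<Sum>i. \<alpha> i x) * fst h + (\<Sum>i. \<beta> i x) * snd h) = u * fst h + v * snd h"
            by (simp add: u_def v_def sum.distrib algebra_simps sum_distrib_left)
          also have "norm \<dots> \<le> norm u * norm (fst h) + norm v * norm (snd h)"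
            by (metis norm_mult norm_triangle_ineq)
          also have "\<dots> \<le> e / 2 * norm h + e / 2 * norm h"
            using uv that norm_fst_le[of "fst h" "snd h"] norm_snd_le[of "snd h" "fst h"]
            by (intro add_mono mult_mono) auto
          finally show "norm ((\<Sum>i<n. \<alpha> i x * fst h + \<beta> i x * snd h) -
              ((\<Sum>i. \<alpha> i x) * fst h + (\<Sum>i. \<beta> i x) * snd h)) \<le> e * norm h"
            by simp
        qed
      qed
    qed
    show "p \<in> S" "(\<lambda>n. f n p) sums F p"
      using pS S_bidisc f_sums[of p] by auto
  qed
  then obtain g where g: "\<And>x. x \<in> S \<Longrightarrow> (\<lambda>n. f n x) sums g x"
    and dg: "\<And>x. x \<in> S \<Longrightarrow>
      (g has_derivative (\<lambda>h. (\<Sum>i. \<alpha> i x) * fst h + (\<Sum>i. \<beta> i x) * snd h)) (at x within S)"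
    by blast
  have "F x = g x" if "x \<in> S" for x
    using that S_bidisc by (intro sums_unique2[OF f_sums g]) auto
  then have "(F has_derivative
      (\<lambda>h. (\<Sum>i. \<alpha> i p) * fst h + (\<Sum>i. \<beta> i p) * snd h)) (at p within S)"
    by (rule has_derivative_transform[OF pS _ dg[OF pS]])
  \<comment> \<open>As \<open>S\<close> is open, the derivative within \<open>S\<close> is a full
    derivative at \<open>p\<close>, hence also one within \<open>bidisc\<close>.\<close>
  then have "(F has_derivative
      (\<lambda>h. (\<Sum>i. \<alpha> i p) * fst h + (\<Sum>i. \<beta> i p) * snd h)) (at p within bidisc)"
    using at_within_open[OF pS \<open>open S\<close>] has_derivative_at_withinI by metis
  then show "\<exists>A B. (F has_derivative (\<lambda>h. A * fst h + B * snd h)) (at p within bidisc)"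
    by blast
qed

text \<open>Chain rule for the holomorphic map \<open>(z1, z2) \<mapsto> (z1 / z2, z2)\<close> from
  the Hartogs triangle into the bidisc; the composed derivative is again complex-linear.\<close>

lemma holomorphic2_on_hartogs_pullback:
  assumes F: "holomorphic2_on F bidisc"
    and f: "\<And>z. z \<in> hartogs_triangle \<Longrightarrow> f z = F (fst z / snd z, snd z)"
  shows "holomorphic2_on f hartogs_triangle"
  unfolding holomorphic2_on_def
proof
  fix z assume z: "z \<in> hartogs_triangle"
  define g where "g z = (fst z / snd z, snd z)" for z :: "complex \<times> complex"
  have z2: "snd z \<noteq> 0" and gz: "g z \<in> bidisc"
    using z by (auto simp: hartogs_triangle_def mem_bidisc g_def norm_divide divide_less_eq)
  obtain A B where "(F has_derivative (\<lambda>h. A * fst h + B * snd h)) (at (g z) within bidisc)"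
    using F gz unfolding holomorphic2_on_def by blast
  then have dF: "(F has_derivative (\<lambda>h. A * fst h + B * snd h)) (at (g z))"
    using at_within_open[OF gz open_bidisc] by simp
  have "(g has_derivative (\<lambda>h. (fst h / snd z - fst z * snd h / (snd z)\<^sup>2, snd h)))
      (at z within hartogs_triangle)"
    unfolding g_def using z2
    by (auto intro!: derivative_eq_intros ext simp: field_simps power2_eq_square)
  from has_derivative_compose[OF this dF]
  have "((\<lambda>x. F (g x)) has_derivative
      (\<lambda>h. A / snd z * fst h + (B - A * fst z / (snd z)\<^sup>2) * snd h)) (at z within hartogs_triangle)"
    by (simp add: algebra_simps)
  then have "(f has_derivative
      (\<lambda>h. A / snd z * fst h + (B - A * fst z / (snd z)\<^sup>2) * snd h)) (at z within hartogs_triangle)"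
    by (rule has_derivative_transform[rotated 2]) (auto simp: z f g_def)
  then show "\<exists>A B. (f has_derivative (\<lambda>h. A * fst h + B * snd h)) (at z within hartogs_triangle)"
    by blast
qed

section \<open>Sums of power series on the bidisc\<close>

text \<open>The value 0 off the bidisc follows the convention of \<open>holo_space\<close>.\<close>

definition bidisc_series :: "(nat \<times> nat \<Rightarrow> complex) \<Rightarrow> complex \<times> complex \<Rightarrow> complex" where
  "bidisc_series b w =
     (if w \<in> bidisc then \<Sum>\<^sub>\<infinity>i. b i * fst w ^ fst i * snd w ^ snd i else 0)"

text \<open>Only \<open>w2 \<noteq> 0\<close> is assumed, as this is what the Hartogs triangle sees; \<open>w2 = 0\<close> follows because
  the terms of the series increase in modulus with \<open>cmod w2\<close>.\<close>

lemma bidisc_expansion_bidisc_series: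
  assumes "\<And>w1 w2. w2 \<noteq> 0 \<Longrightarrow> cmod w1 < 1 \<Longrightarrow> cmod w2 < 1 \<Longrightarrow>
    (\<lambda>(j, k). b (j, k) * w1 ^ j * w2 ^ k) summable_on UNIV"
  shows "bidisc_expansion (bidisc_series b) b"
  unfolding bidisc_expansion_def
proof (intro ballI, clarify)
  fix w1 w2 :: complex
  assume w: "(w1, w2) \<in> bidisc"
  \<comment> \<open>The midpoint of \<open>cmod w2\<close> and 1 is positive even for
    \<open>w2 = 0\<close>, so the hypothesis applies to it, and it dominates
    \<open>cmod w2\<close>.\<close>
  define t where "t = (1 + cmod w2) / 2"
  have t: "0 < t" "t < 1" "cmod w2 \<le> t"
    using w by (auto simp: t_def mem_bidisc add_pos_nonneg)
  have "(\<lambda>i. cmod (b i * w1 ^ fst i * of_real t ^ snd i)) summable_on UNIV"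
    using w t assms[of "of_real t" w1]
    by (simp add: mem_bidisc case_prod_unfold flip: summable_on_iff_abs_summable_on_complex)
  then have "(\<lambda>i. cmod (b i * w1 ^ fst i * w2 ^ snd i)) summable_on UNIV"
    by (rule Infinite_Sum.abs_summable_on_comparison_test)
      (use t in \<open>auto simp: norm_mult norm_power intro!: mult_left_mono power_mono\<close>)
  then show "((\<lambda>(j, k). b (j, k) * w1 ^ j * w2 ^ k) has_sum bidisc_series b (w1, w2)) UNIV"
    using w by (simp add: bidisc_series_def case_prod_unfold abs_summable_summable)
qed

lemma bidisc_series_eqI:
  assumes "bidisc_expansion F b" "\<And>w. w \<notin> bidisc \<Longrightarrow> F w = 0"
  shows "bidisc_series b = F"
proof
  show "bidisc_series b w = F w" for w
    using assms(2) infsumI[OF bidisc_expansion_mem[OF assms(1)]] by (simp add: bidisc_series_def)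
qed

lemma bidisc_coeffs_eqI:
  assumes "bidisc_expansion F b"
  shows "bidisc_coeffs F = b"
  unfolding bidisc_coeffs_def
proof (rule the_equality[where P = "bidisc_expansion F", OF assms])
  show "b' = b" if "bidisc_expansion F b'" for b'
    using that assms by (intro powser2_coeffs_unique[of _ F]) (auto simp: bidisc_expansion_def mem_bidisc)
qed

section \<open>Reindexing Hartogs expansions as bidisc expansions\<close>

text \<open>The map starts from the bidisc indices so that precomposition with it turns Hartogs
  coefficients into bidisc coefficients.\<close>

definition hartogs_of_bidisc_index :: "nat \<times> nat \<Rightarrow> nat \<times> int" where
  "hartogs_of_bidisc_index = (\<lambda>(j, m). (j, int m - int j))"

lemma bij_betw_hartogs_of_bidisc_index: "bij_betw hartogs_of_bidisc_index UNIV hartogs_index"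
  by (rule bij_betw_byWitness[where f' = "\<lambda>(j, k). (j, nat (k + int j))"])
    (auto simp: hartogs_of_bidisc_index_def hartogs_index_def)

lemma hartogs_of_bidisc_index_mem: "hartogs_of_bidisc_index i \<in> hartogs_index"
  using bij_betw_hartogs_of_bidisc_index by (auto simp: bij_betw_def)

text \<open>The substitution \<open>(w1, w2) \<mapsto> (w1 * w2, w2)\<close> maps the part of the
  bidisc with \<open>w2 \<noteq> 0\<close> onto the Hartogs triangle, with inverse
  \<open>(z1, z2) \<mapsto> (z1 / z2, z2)\<close>.\<close>

lemma hartogs_expansion_iff:
  "hartogs_expansion f a \<longleftrightarrow>
     (\<forall>i. i \<notin> hartogs_index \<longrightarrow> a i = 0) \<and>
     (\<forall>w1 w2. w2 \<noteq> 0 \<longrightarrow> cmod w1 < 1 \<longrightarrow> cmod w2 < 1 \<longrightarrow>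
        ((\<lambda>(j, m). (a \<circ> hartogs_of_bidisc_index) (j, m) * w1 ^ j * w2 ^ m) has_sum f (w1 * w2, w2)) UNIV)"
proof -
  have sum_iff: "((\<lambda>(j, k). a (j, k) * (w1 * w2) ^ j * w2 powi k) has_sum f (w1 * w2, w2)) hartogs_index \<longleftrightarrow>
      ((\<lambda>(j, m). (a \<circ> hartogs_of_bidisc_index) (j, m) * w1 ^ j * w2 ^ m) has_sum f (w1 * w2, w2)) UNIV"
    if "w2 \<noteq> 0" for w1 w2
    unfolding has_sum_reindex_bij_betw[OF bij_betw_hartogs_of_bidisc_index, symmetric]
    using that
    by (intro has_sum_cong)
      (auto simp: hartogs_of_bidisc_index_def power_int_diff power_mult_distrib)
  have "(\<forall>(z1, z2)\<in>hartogs_triangle. P z1 z2) \<longleftrightarrow>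
      (\<forall>w1 w2. w2 \<noteq> 0 \<longrightarrow> cmod w1 < 1 \<longrightarrow> cmod w2 < 1 \<longrightarrow> P (w1 * w2) w2)" (is "?L = ?R") for P
  proof
    show ?R if ?L
      using that by (auto simp: hartogs_triangle_def norm_mult)
    show ?L if R: ?R
    proof clarify
      fix z1 z2 assume "(z1, z2) \<in> hartogs_triangle"
      then have "z2 \<noteq> 0" "cmod (z1 / z2) < 1" "cmod z2 < 1"
        by (auto simp: hartogs_triangle_def norm_divide divide_less_eq)
      with R have "P (z1 / z2 * z2) z2"
        by blast
      with \<open>z2 \<noteq> 0\<close> show "P z1 z2"
        by simp
    qed
  qed
  then show ?thesis
    unfolding hartogs_expansion_def by (simp add: sum_iff)
qed

text \<open>On \<open>hartogs_index\<close> this is uniqueness for the reindexed power series;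
  elsewhere both families are 0 by normalisation.\<close>

lemma hartogs_coeffs_eqI:
  assumes a: "hartogs_expansion f a"
  shows "hartogs_coeffs f = a"
  unfolding hartogs_coeffs_def
proof (rule the_equality[where P = "hartogs_expansion f", OF a])
  fix a' assume a': "hartogs_expansion f a'"
  have "a' \<circ> hartogs_of_bidisc_index = a \<circ> hartogs_of_bidisc_index"
    using a a' unfolding hartogs_expansion_iff
    by (intro powser2_coeffs_unique[of _ "\<lambda>(w1, w2). f (w1 * w2, w2)"]) auto
  then have "a' i = a i" if "i \<in> hartogs_index" for i
    using that bij_betw_imp_surj_on[OF bij_betw_hartogs_of_bidisc_index] by (metis comp_apply imageE)
  moreover have "a' i = a i" if "i \<notin> hartogs_index" for i
    using that a a' unfolding hartogs_expansion_def by metis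
  ultimately show "a' = a"
    by blast
qed

lemma hartogs_weighted_of_bidisc_index:
  "hartogs_weighted a (hartogs_of_bidisc_index i) = bidisc_weighted (a \<circ> hartogs_of_bidisc_index) i"
  by (cases i) (simp add: hartogs_weighted_def bidisc_weighted_def hartogs_of_bidisc_index_def)

section \<open>The isometry and its properties\<close>

text \<open>Defined through the coefficients rather than by substitution, because
  \<open>(w1 * w2, w2)\<close> leaves the Hartogs triangle when \<open>w2 = 0\<close>.\<close>

definition hartogs_to_bidisc ::
    "(complex \<times> complex \<Rightarrow> complex) \<Rightarrow> complex \<times> complex \<Rightarrow> complex" where
  "hartogs_to_bidisc f = bidisc_series (hartogs_coeffs f \<circ> hartogs_of_bidisc_index)"

lemma hartogs_to_bidisc_eq:
  "hartogs_expansion f a \<Longrightarrow> hartogs_to_bidisc f = bidisc_series (a \<circ> hartogs_of_bidisc_index)"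
  by (simp add: hartogs_to_bidisc_def hartogs_coeffs_eqI)

lemma bidisc_expansion_hartogs_to_bidisc:
  assumes a: "hartogs_expansion f a"
  shows "bidisc_expansion (hartogs_to_bidisc f) (a \<circ> hartogs_of_bidisc_index)"
  unfolding hartogs_to_bidisc_eq[OF a]
  using a unfolding hartogs_expansion_iff
  by (intro bidisc_expansion_bidisc_series) (blast intro: has_sum_imp_summable)

lemma hartogs_to_bidisc_outside: "w \<notin> bidisc \<Longrightarrow> hartogs_to_bidisc f w = 0"
  by (simp add: hartogs_to_bidisc_def bidisc_series_def)

lemma hartogs_to_bidisc_mem:
  assumes "f \<in> dirichlet_hartogs"
  shows "hartogs_to_bidisc f \<in> dirichlet_bidisc"
proof -
  obtain a where a: "hartogs_expansion f a" and sm: "hartogs_weighted a summable_on hartogs_index"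
    using assms by (auto simp: dirichlet_hartogs_def)
  note e = bidisc_expansion_hartogs_to_bidisc[OF a]
  have "bidisc_weighted (a \<circ> hartogs_of_bidisc_index) summable_on UNIV"
    using sm summable_on_reindex_bij_betw[OF bij_betw_hartogs_of_bidisc_index, of "hartogs_weighted a"]
    by (simp add: hartogs_weighted_of_bidisc_index)
  then show ?thesis
    using e bidisc_expansion_imp_holomorphic2_on[OF e] hartogs_to_bidisc_outside
    by (auto simp: dirichlet_bidisc_def holo_space_def)
qed

text \<open>The preimage is the pullback of \<open>F\<close> along
  \<open>(z1, z2) \<mapsto> (z1 / z2, z2)\<close>, extended by 0.\<close>

lemma hartogs_to_bidisc_surj:
  assumes "F \<in> dirichlet_bidisc"
  shows "F \<in> hartogs_to_bidisc ` dirichlet_hartogs"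
proof -
  obtain b where b: "bidisc_expansion F b" and sm: "bidisc_weighted b summable_on UNIV"
    and hol: "holomorphic2_on F bidisc" and F0: "\<And>w. w \<notin> bidisc \<Longrightarrow> F w = 0"
    using assms by (auto simp: dirichlet_bidisc_def holo_space_def)
  define f where "f z = (if z \<in> hartogs_triangle then F (fst z / snd z, snd z) else 0)" for z
  \<comment> \<open>The second index is \<open>m = j + k\<close>, which is nonnegative on
    \<open>hartogs_index\<close>, so \<open>nat\<close> loses nothing there; the default 0 is the
    normalisation in \<open>hartogs_expansion\<close>.\<close>
  define a where "a i = (if i \<in> hartogs_index then b (fst i, nat (snd i + int (fst i))) else 0)" for i
  have ab: "a \<circ> hartogs_of_bidisc_index = b"
    using hartogs_of_bidisc_index_mem by (auto simp: a_def hartogs_of_bidisc_index_def)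
  have f_eq: "f (w1 * w2, w2) = F (w1, w2)" if "w2 \<noteq> 0" "cmod w1 < 1" "cmod w2 < 1" for w1 w2
    using that by (simp add: f_def hartogs_triangle_def norm_mult)
  have e: "hartogs_expansion f a"
    unfolding hartogs_expansion_iff ab using b
    by (auto simp: a_def f_eq bidisc_expansion_def mem_bidisc)
  have "hartogs_weighted a summable_on hartogs_index"
    using sm summable_on_reindex_bij_betw[OF bij_betw_hartogs_of_bidisc_index, of "hartogs_weighted a"]
    by (simp add: hartogs_weighted_of_bidisc_index ab)
  moreover have "holomorphic2_on f hartogs_triangle"
    using hol by (rule holomorphic2_on_hartogs_pullback) (simp add: f_def)
  ultimately have "f \<in> dirichlet_hartogs"
    using e by (auto simp: dirichlet_hartogs_def holo_space_def f_def)
  moreover have "hartogs_to_bidisc f = F"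
    using bidisc_series_eqI[OF b F0] by (simp add: hartogs_to_bidisc_eq[OF e] ab)
  ultimately show ?thesis
    by blast
qed

text \<open>Expansions add termwise on both domains, and uniqueness of the coefficients identifies
  those of the sum.\<close>

lemma hartogs_to_bidisc_add:
  assumes "hartogs_expansion f a" "hartogs_expansion g b"
  shows "hartogs_to_bidisc (\<lambda>z. f z + g z) = (\<lambda>w. hartogs_to_bidisc f w + hartogs_to_bidisc g w)"
proof -
  have "hartogs_expansion (\<lambda>z. f z + g z) (\<lambda>i. a i + b i)"
    using assms has_sum_add
    by (fastforce simp: hartogs_expansion_def case_prod_unfold distrib_right)
  moreover have "bidisc_series ((\<lambda>i. a i + b i) \<circ> hartogs_of_bidisc_index) =
      (\<lambda>w. hartogs_to_bidisc f w + hartogs_to_bidisc g w)"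
    using assms[THEN bidisc_expansion_hartogs_to_bidisc] has_sum_add
    by (intro bidisc_series_eqI)
      (fastforce simp: hartogs_to_bidisc_outside bidisc_expansion_def case_prod_unfold distrib_right)+
  ultimately show ?thesis
    by (simp add: hartogs_to_bidisc_eq)
qed

lemma hartogs_to_bidisc_scale:
  assumes "hartogs_expansion f a"
  shows "hartogs_to_bidisc (\<lambda>z. c * f z) = (\<lambda>w. c * hartogs_to_bidisc f w)"
proof -
  have "hartogs_expansion (\<lambda>z. c * f z) (\<lambda>i. c * a i)"
    using assms has_sum_cmult_right[where c = c]
    by (fastforce simp: hartogs_expansion_def case_prod_unfold mult.assoc)
  moreover have "bidisc_series ((\<lambda>i. c * a i) \<circ> hartogs_of_bidisc_index) =
      (\<lambda>w. c * hartogs_to_bidisc f w)"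
    using bidisc_expansion_hartogs_to_bidisc[OF assms] has_sum_cmult_right[where c = c]
    by (intro bidisc_series_eqI)
      (fastforce simp: hartogs_to_bidisc_outside bidisc_expansion_def case_prod_unfold mult.assoc)+
  ultimately show ?thesis
    by (simp add: hartogs_to_bidisc_eq)
qed

text \<open>Uniqueness lets both norms be computed from \<open>a\<close>; the two weighted sums then
  differ only by a bijection of the indices.\<close>

lemma norm_hartogs_to_bidisc:
  assumes a: "hartogs_expansion f a"
  shows "dirichlet_bidisc_norm (hartogs_to_bidisc f) = dirichlet_hartogs_norm f"
  unfolding dirichlet_bidisc_norm_def dirichlet_hartogs_norm_def hartogs_coeffs_eqI[OF a]
    bidisc_coeffs_eqI[OF bidisc_expansion_hartogs_to_bidisc[OF a]]
  using infsum_reindex_bij_betw[OF bij_betw_hartogs_of_bidisc_index, of "hartogs_weighted a"]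
  by (simp add: hartogs_weighted_of_bidisc_index)

theorem theorem3:
  "\<exists>T :: (complex \<times> complex \<Rightarrow> complex) \<Rightarrow> (complex \<times> complex \<Rightarrow> complex).
     T ` dirichlet_hartogs = dirichlet_bidisc \<and>
     (\<forall>f\<in>dirichlet_hartogs. \<forall>g\<in>dirichlet_hartogs.
        T (\<lambda>z. f z + g z) = (\<lambda>w. T f w + T g w)) \<and>
     (\<forall>c. \<forall>f\<in>dirichlet_hartogs. T (\<lambda>z. c * f z) = (\<lambda>w. c * T f w)) \<and>
     (\<forall>f\<in>dirichlet_hartogs. dirichlet_bidisc_norm (T f) = dirichlet_hartogs_norm f)"
proof (rule exI[of _ hartogs_to_bidisc], intro conjI)
  have expansion: "\<exists>a. hartogs_expansion f a" if "f \<in> dirichlet_hartogs" for f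
    using that by (auto simp: dirichlet_hartogs_def)
  show "hartogs_to_bidisc ` dirichlet_hartogs = dirichlet_bidisc"
    using hartogs_to_bidisc_mem hartogs_to_bidisc_surj by blast
  show "\<forall>f\<in>dirichlet_hartogs. \<forall>g\<in>dirichlet_hartogs. hartogs_to_bidisc (\<lambda>z. f z + g z) =
      (\<lambda>w. hartogs_to_bidisc f w + hartogs_to_bidisc g w)"
    using expansion hartogs_to_bidisc_add by blast
  show "\<forall>c. \<forall>f\<in>dirichlet_hartogs.
      hartogs_to_bidisc (\<lambda>z. c * f z) = (\<lambda>w. c * hartogs_to_bidisc f w)"
    using expansion hartogs_to_bidisc_scale by blast
  show "\<forall>f\<in>dirichlet_hartogs.
      dirichlet_bidisc_norm (hartogs_to_bidisc f) = dirichlet_hartogs_norm f"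
    using expansion norm_hartogs_to_bidisc by blast
qed

end
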